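(* The following four identities hold: \[ \sum_{n\geq 1} q^n (q^n;q)_\infty (-q^{n+1};q)_{\infty}^2(q^{3};q^3)_{n-1} = \frac{(q^2;q^2)_\infty}{(q;q^2)_\infty} - (q^3;q^3)_\infty, \] \[ \sum_{n\geq 1} q^n (q^n;q)_\infty (q^{n+1};q)_{\infty}^2(q^{3};q^3)_{n-1} = \frac{1}{3} \big( (q^3;q^3)_\infty -(q;q)_\infty^3 \big), \] \[ \sum_{n\geq 1}q^n (-q^n;q)_\infty (-q^{n+1};q)_{\infty}^2(-q^{3};q^3)_{n-1} = \frac{1}{3} \big( (-q;q)_\infty^3-(-q^3;q^3)_\infty \big), \] \[ \sum_{n\geq 1}q^n (-q^n;q)_\infty (q^{n+1};q)_{\infty}^2(-q^{3};q^3)_{n-1} = (-q^3;q^3)_\infty -(-q;q)_\infty(q;q)_\infty^2. \]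
   Context: $q$ is a complex number with $|q|<1$. $(a;q)_0=1$, $(a;q)_n=\prod_{j=0}^{n-1}(1-aq^j)$, $(a;q)_\infty=\prod_{j\ge0}(1-aq^j)$. *)

theory Defs
  imports "HOL-Analysis.Analysis"
begin

definition qpoch :: "complex \<Rightarrow> complex \<Rightarrow> nat \<Rightarrow> complex" where
  "qpoch a q n = (\<Prod>j<n. 1 - a * q ^ j)"

definition qpoch_inf :: "complex \<Rightarrow> complex \<Rightarrow> complex" where
  "qpoch_inf a q = (\<Prod>j. 1 - a * q ^ j)"

(* prodinf is only meaningful for convergent products; a vanishing factor is allowed. *)
lemma qpoch_inf_convergent:
  fixes a q :: complex
  assumes "norm q < 1"
  shows "convergent_prod (\<lambda>j. 1 - a * q ^ j)"
proof -
  have "summable (\<lambda>j. norm (- a * q ^ j))"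
    using assms by (simp add: norm_mult norm_power summable_mult summable_geometric)
  hence "abs_convergent_prod (\<lambda>j. 1 + (- a * q ^ j))"
    by (intro summable_imp_abs_convergent_prod) simp
  thus ?thesis
    using abs_convergent_prod_imp_convergent_prod by fastforce
qed

end

theory Submission
  imports Defs
begin

text \<open>With \<open>x = q ^ n\<close> and signs \<open>a\<close>, \<open>b\<close> (so that \<open>a\<^sup>2 = b\<^sup>2 = 1\<close>) one has
  \<open>(1 - a * x ^ 3) - (1 - a * x) * (1 - b * x)\<^sup>2 = (a + 2 * b) * x * (1 - a * x)\<close>.
  Hence, up to the factor \<open>a + 2 * b\<close>, the summand is the difference \<open>T (n + 1) - T n\<close> of
  \<open>T n = (a * q ^ n; q)\<^sub>\<infinity> * (b * q ^ n; q)\<^sub>\<infinity>\<^sup>2 * (a * q ^ 3; q ^ 3)\<^sub>n\<^sub>-\<^sub>1\<close>,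
  and each of the four series telescopes for one of the four choices of signs.  Only the first
  identity needs more: Euler's \<open>(-q; q)\<^sub>\<infinity> * (q; q\<^sup>2)\<^sub>\<infinity> = 1\<close>.\<close>

lemma norm_power_lt_1:
  fixes q :: "'a :: real_normed_div_algebra"
  assumes "norm q < 1" "0 < k"
  shows "norm (q ^ k) < 1"
  using assms by (simp add: norm_power power_less_one_iff)

lemma qpoch_LIMSEQ:
  assumes "norm q < 1"
  shows "qpoch a q \<longlonglongrightarrow> qpoch_inf a q"
  using convergent_prod_LIMSEQ[OF qpoch_inf_convergent[OF assms, of a]]
  unfolding qpoch_def qpoch_inf_def LIMSEQ_lessThan_iff_atMost .

lemma qpoch_inf_unfold:
  assumes "norm q < 1"
  shows "qpoch_inf a q = (1 - a) * qpoch_inf (a * q) q"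
proof (rule LIMSEQ_unique)
  show "(\<lambda>n. qpoch a q (Suc n)) \<longlonglongrightarrow> qpoch_inf a q"
    by (rule LIMSEQ_Suc[OF qpoch_LIMSEQ[OF assms]])
  have "qpoch a q (Suc n) = (1 - a) * qpoch (a * q) q n" for n
    unfolding qpoch_def prod.lessThan_Suc_shift by (simp add: mult.assoc)
  then show "(\<lambda>n. qpoch a q (Suc n)) \<longlonglongrightarrow> (1 - a) * qpoch_inf (a * q) q"
    by (simp add: tendsto_mult_left qpoch_LIMSEQ[OF assms])
qed

text \<open>Compare factorwise with \<open>1 + t \<le> exp t\<close> and sum the exponents as a
  geometric series. The bound is independent of \<open>n\<close>, so it passes to the limit; it
  vanishes as \<open>a\<close> tends to 0, which forces the tails
  \<open>qpoch_inf (a * q ^ n) q\<close> to tend to 1.\<close>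

lemma norm_qpoch_inf_minus_1_le:
  assumes "norm q < 1"
  shows "norm (qpoch_inf a q - 1) \<le> exp (norm a / (1 - norm q)) - 1"
proof (rule LIMSEQ_le_const2)
  show "(\<lambda>n. norm (qpoch a q n - 1)) \<longlonglongrightarrow> norm (qpoch_inf a q - 1)"
    by (intro tendsto_intros qpoch_LIMSEQ assms)
  have "norm (qpoch a q n - 1) \<le> exp (norm a / (1 - norm q)) - 1" for n
  proof -
    have "norm (qpoch a q n - 1) \<le> (\<Prod>j<n. 1 + norm (- a * q ^ j)) - 1"
      using norm_prod_minus1_le_prod_minus1[of "\<lambda>j. - a * q ^ j" "{..<n}"]
      by (simp add: qpoch_def)
    also have "(\<Prod>j<n. 1 + norm (- a * q ^ j)) \<le> exp (\<Sum>j<n. norm (- a * q ^ j))"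
      unfolding exp_sum[OF finite_lessThan] by (intro prod_mono) (auto simp: add_nonneg_nonneg)
    also have "(\<Sum>j<n. norm (- a * q ^ j)) = norm a * (\<Sum>j<n. norm q ^ j)"
      by (simp add: norm_mult norm_power sum_distrib_left)
    also have "\<dots> \<le> norm a * (\<Sum>j. norm q ^ j)"
      using assms by (intro mult_left_mono sum_le_suminf) (auto simp: summable_geometric)
    also have "(\<Sum>j. norm q ^ j) = 1 / (1 - norm q)"
      using assms by (simp add: suminf_geometric)
    finally show ?thesis by simp
  qed
  then show "\<exists>N. \<forall>n\<ge>N. norm (qpoch a q n - 1) \<le> exp (norm a / (1 - norm q)) - 1"
    by blast
qed

lemma qpoch_inf_shift_LIMSEQ:
  assumes "norm q < 1"
  shows "(\<lambda>n. qpoch_inf (a * q ^ n) q) \<longlonglongrightarrow> 1"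
proof -
  have "(\<lambda>n. norm (a * q ^ n)) \<longlonglongrightarrow> 0"
    using tendsto_mult_right_zero[OF LIMSEQ_power_zero[OF assms], of a] tendsto_norm_zero by blast
  then have "(\<lambda>n. exp (norm (a * q ^ n) / (1 - norm q)) - 1) \<longlonglongrightarrow> exp (0 / (1 - norm q)) - 1"
    using assms by (intro tendsto_intros) auto
  then have "(\<lambda>n. exp (norm (a * q ^ n) / (1 - norm q)) - 1) \<longlonglongrightarrow> 0"
    by simp
  then have "(\<lambda>n. qpoch_inf (a * q ^ n) q - 1) \<longlonglongrightarrow> 0"
    by (rule Lim_null_comparison[OF always_eventually, rotated])
      (use norm_qpoch_inf_minus_1_le[OF assms] in blast)
  then show ?thesis
    by (simp add: LIM_zero_iff)
qed

text \<open>Factors with the same index pair up as a difference of squares.\<close>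

lemma qpoch_inf_mult_minus:
  assumes "norm q < 1"
  shows "qpoch_inf a q * qpoch_inf (- a) q = qpoch_inf (a\<^sup>2) (q\<^sup>2)"
proof (rule LIMSEQ_unique)
  show "(\<lambda>n. qpoch a q n * qpoch (- a) q n) \<longlonglongrightarrow> qpoch_inf a q * qpoch_inf (- a) q"
    by (intro tendsto_intros qpoch_LIMSEQ assms)
  have "qpoch a q n * qpoch (- a) q n = qpoch (a\<^sup>2) (q\<^sup>2) n" for n
    unfolding qpoch_def prod.distrib[symmetric]
    by (intro prod.cong refl) (simp add: power2_eq_square power_mult_distrib algebra_simps)
  then show "(\<lambda>n. qpoch a q n * qpoch (- a) q n) \<longlonglongrightarrow> qpoch_inf (a\<^sup>2) (q\<^sup>2)"
    by (simp add: qpoch_LIMSEQ norm_power_lt_1[OF assms])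
qed

text \<open>Split the exponents of \<open>q\<close> by parity; partial products of even length
  suffice, being a subsequence.\<close>

lemma qpoch_inf_even_odd:
  assumes "norm q < 1"
  shows "qpoch_inf a q = qpoch_inf a (q\<^sup>2) * qpoch_inf (a * q) (q\<^sup>2)"
proof (rule LIMSEQ_unique)
  have "strict_mono (\<lambda>n::nat. 2 * n)"
    by (simp add: strict_mono_def)
  from LIMSEQ_subseq_LIMSEQ[OF qpoch_LIMSEQ[OF assms] this]
  show "(\<lambda>n. qpoch a q (2 * n)) \<longlonglongrightarrow> qpoch_inf a q"
    by (simp add: o_def)
  have "qpoch a q (2 * n) = qpoch a (q\<^sup>2) n * qpoch (a * q) (q\<^sup>2) n" for n
    by (induction n) (simp_all add: qpoch_def power_mult[symmetric] mult_ac)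
  then show "(\<lambda>n. qpoch a q (2 * n)) \<longlonglongrightarrow> qpoch_inf a (q\<^sup>2) * qpoch_inf (a * q) (q\<^sup>2)"
    by (simp add: tendsto_mult qpoch_LIMSEQ norm_power_lt_1[OF assms])
qed

lemma qpoch_inf_self_nonzero:
  assumes "norm q < 1"
  shows "qpoch_inf q q \<noteq> 0"
  unfolding qpoch_inf_def
proof (rule prodinf_nonzero[OF qpoch_inf_convergent[OF assms]])
  show "1 - q * q ^ j \<noteq> 0" for j
    using norm_power_lt_1[OF assms, of "Suc j"] by force
qed

text \<open>The parity split at \<open>a = q\<close> leaves the factor
  \<open>qpoch_inf (q\<^sup>2) (q\<^sup>2)\<close>, which the difference of squares turns into
  \<open>qpoch_inf q q * qpoch_inf (- q) q\<close>; the nonzero \<open>qpoch_inf q q\<close> then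
  cancels.\<close>

lemma euler_qpoch_inf:
  assumes "norm q < 1"
  shows "qpoch_inf (- q) q * qpoch_inf q (q\<^sup>2) = 1"
proof -
  have "qpoch_inf q q = qpoch_inf q (q\<^sup>2) * (qpoch_inf q q * qpoch_inf (- q) q)"
    using qpoch_inf_even_odd[OF assms, of q] qpoch_inf_mult_minus[OF assms, of q]
    by (simp add: power2_eq_square)
  then show ?thesis
    using qpoch_inf_self_nonzero[OF assms] by (simp add: mult_ac)
qed

text \<open>Keeping the signs as parameters treats all four series at once: the numerator is the
  limit of the telescoping sequence minus its initial term.\<close>

lemma qpoch_telescoping_has_sum:
  fixes a b q :: complex
  assumes q: "norm q < 1" and a: "a\<^sup>2 = 1" and b: "b\<^sup>2 = 1"
  shows "((\<lambda>n. q ^ n * qpoch_inf (a * q ^ n) q * (qpoch_inf (b * q ^ (n + 1)) q)\<^sup>2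
            * qpoch (a * q ^ 3) (q ^ 3) (n - 1))
    has_sum ((qpoch_inf (a * q ^ 3) (q ^ 3) - qpoch_inf (a * q) q * (qpoch_inf (b * q) q)\<^sup>2)
             / (a + 2 * b))) {1..}"
proof -
  \<comment> \<open>Indices start at 0 here, so \<open>T n\<close> is the informal T at
    \<open>n + 1\<close>, and the summand at \<open>Suc n\<close> is \<open>q ^ Suc n * B n\<close>.
    This avoids the truncated \<open>n - 1\<close>.\<close>
  define T where "T n = qpoch_inf (a * q ^ Suc n) q * (qpoch_inf (b * q ^ Suc n) q)\<^sup>2
    * qpoch (a * q ^ 3) (q ^ 3) n" for n
  define B where "B n = qpoch_inf (a * q ^ Suc n) q * (qpoch_inf (b * q ^ Suc (Suc n)) q)\<^sup>2
    * qpoch (a * q ^ 3) (q ^ 3) n" for n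
  have "a = 1 \<or> a = - 1" "b = 1 \<or> b = - 1"
    using a b by (simp_all add: power2_eq_1_iff)
  then have ab: "a + 2 * b \<noteq> 0"
    by auto
  have q3: "norm (q ^ 3) < 1"
    using norm_power_lt_1[OF q] by simp
  note lim = LIMSEQ_Suc[OF qpoch_inf_shift_LIMSEQ[OF q]] qpoch_LIMSEQ[OF q3]
  have T_lim: "T \<longlonglongrightarrow> 1 * 1\<^sup>2 * qpoch_inf (a * q ^ 3) (q ^ 3)"
    unfolding T_def by (intro tendsto_intros lim)
  have B_lim: "B \<longlonglongrightarrow> 1 * 1\<^sup>2 * qpoch_inf (a * q ^ 3) (q ^ 3)"
    unfolding B_def by (intro tendsto_intros lim LIMSEQ_Suc[OF lim(1)])
  have key: "(1 - a * x ^ 3) - (1 - a * x) * (1 - b * x)\<^sup>2 = (a + 2 * b) * x * (1 - a * x)" for x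
    using a b by algebra
  have diff: "q ^ Suc n * B n = (T (Suc n) - T n) / (a + 2 * b)" for n
  proof -
    define x where "x = q ^ Suc n"
    \<comment> \<open>\<open>C\<close> is the common factor of \<open>T n\<close>,
      \<open>T (Suc n)\<close> and \<open>B n\<close>; dividing it out reduces the claim to the
      polynomial identity \<open>key\<close>.\<close>
    define C where "C = qpoch_inf (a * x * q) q * (qpoch_inf (b * x * q) q)\<^sup>2
      * qpoch (a * q ^ 3) (q ^ 3) n"
    have unf: "qpoch_inf (c * x) q = (1 - c * x) * qpoch_inf (c * x * q) q" for c
      by (rule qpoch_inf_unfold[OF q])
    have shift: "c * q ^ Suc (Suc n) = c * x * q" for c
      by (simp add: x_def)
    have "qpoch (a * q ^ 3) (q ^ 3) (Suc n) = qpoch (a * q ^ 3) (q ^ 3) n * (1 - a * x ^ 3)"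
      by (simp add: qpoch_def x_def power_mult_distrib flip: power_mult) (simp add: mult_ac)
    then have "T (Suc n) = (1 - a * x ^ 3) * C"
      by (simp only: T_def shift C_def mult_ac)
    moreover have "T n = (1 - a * x) * (1 - b * x)\<^sup>2 * C"
      by (simp add: T_def C_def unf power_mult_distrib flip: x_def del: power_Suc)
    ultimately have "T (Suc n) - T n = (a + 2 * b) * x * (1 - a * x) * C"
      by (simp only: key[symmetric] left_diff_distrib)
    moreover have "B n = (1 - a * x) * C"
      unfolding B_def C_def shift x_def[symmetric] unf by simp
    ultimately show ?thesis
      using ab by (simp add: x_def[symmetric] del: power_Suc)
  qed
  have "(\<lambda>n. (T (Suc n) - T n) / (a + 2 * b)) sums
      ((1 * 1\<^sup>2 * qpoch_inf (a * q ^ 3) (q ^ 3) - T 0) / (a + 2 * b))"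
    by (intro sums_divide telescope_sums T_lim)
  then have sums: "(\<lambda>n. q ^ Suc n * B n) sums
      ((qpoch_inf (a * q ^ 3) (q ^ 3) - T 0) / (a + 2 * b))"
    by (simp only: diff) simp
  \<comment> \<open>Telescoping only gives convergence in order, whereas \<open>has_sum\<close> is
    unordered. Since \<open>B\<close> converges it is bounded, so the series is dominated by a
    geometric one.\<close>
  obtain K where K: "\<And>n. norm (B n) \<le> K"
    using convergent_imp_Bseq[OF convergentI[OF B_lim]] by (auto simp: Bseq_def)
  have "summable (\<lambda>n. norm (q ^ Suc n * B n))"
  proof (rule summable_comparison_test')
    show "summable (\<lambda>n. norm q ^ Suc n * K)"
      using q by (intro summable_mult2) (simp add: summable_mult summable_geometric)
    show "norm (norm (q ^ Suc n * B n)) \<le> norm q ^ Suc n * K" for n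
      using K by (simp add: norm_mult norm_power mult_left_mono del: power_Suc)
  qed
  from norm_summable_imp_has_sum[OF this sums]
  have "((\<lambda>n. q ^ n * qpoch_inf (a * q ^ n) q * (qpoch_inf (b * q ^ (n + 1)) q)\<^sup>2
            * qpoch (a * q ^ 3) (q ^ 3) (n - 1)) \<circ> Suc
      has_sum ((qpoch_inf (a * q ^ 3) (q ^ 3) - T 0) / (a + 2 * b))) UNIV"
    by (simp add: B_def o_def mult.assoc)
  then have "((\<lambda>n. q ^ n * qpoch_inf (a * q ^ n) q * (qpoch_inf (b * q ^ (n + 1)) q)\<^sup>2
            * qpoch (a * q ^ 3) (q ^ 3) (n - 1))
      has_sum ((qpoch_inf (a * q ^ 3) (q ^ 3) - T 0) / (a + 2 * b))) (range Suc)"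
    by (simp only: has_sum_reindex[OF inj_Suc])
  moreover have "range Suc = {1..}"
    by (auto simp: image_iff Suc_le_eq gr0_conv_Suc)
  moreover have "T 0 = qpoch_inf (a * q) q * (qpoch_inf (b * q) q)\<^sup>2"
    by (simp add: T_def qpoch_def)
  ultimately show ?thesis
    by simp
qed

theorem theorem2p1:
  fixes q :: complex
  assumes "norm q < 1"
  shows
    "((\<lambda>n::nat. q ^ n * qpoch_inf (q ^ n) q * (qpoch_inf (- (q ^ (n + 1))) q)\<^sup>2
          * qpoch (q ^ 3) (q ^ 3) (n - 1))
        has_sum (qpoch_inf (q\<^sup>2) (q\<^sup>2) / qpoch_inf q (q\<^sup>2) - qpoch_inf (q ^ 3) (q ^ 3))) {1..}
    \<and>
    ((\<lambda>n::nat. q ^ n * qpoch_inf (q ^ n) q * (qpoch_inf (q ^ (n + 1)) q)\<^sup>2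
          * qpoch (q ^ 3) (q ^ 3) (n - 1))
        has_sum (1 / 3 * (qpoch_inf (q ^ 3) (q ^ 3) - (qpoch_inf q q) ^ 3))) {1..}
    \<and>
    ((\<lambda>n::nat. q ^ n * qpoch_inf (- (q ^ n)) q * (qpoch_inf (- (q ^ (n + 1))) q)\<^sup>2
          * qpoch (- (q ^ 3)) (q ^ 3) (n - 1))
        has_sum (1 / 3 * ((qpoch_inf (- q) q) ^ 3 - qpoch_inf (- (q ^ 3)) (q ^ 3)))) {1..}
    \<and>
    ((\<lambda>n::nat. q ^ n * qpoch_inf (- (q ^ n)) q * (qpoch_inf (q ^ (n + 1)) q)\<^sup>2
          * qpoch (- (q ^ 3)) (q ^ 3) (n - 1))
        has_sum (qpoch_inf (- (q ^ 3)) (q ^ 3) - qpoch_inf (- q) q * (qpoch_inf q q)\<^sup>2)) {1..}"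
proof -
  note H = qpoch_telescoping_has_sum[OF assms]
  have nz: "qpoch_inf q (q\<^sup>2) \<noteq> 0"
    using euler_qpoch_inf[OF assms] by auto
  \<comment> \<open>One factor \<open>qpoch_inf (- q) q\<close> is absorbed by Euler's identity, the
    other by the difference of squares.\<close>
  have "qpoch_inf q q * (qpoch_inf (- q) q)\<^sup>2 * qpoch_inf q (q\<^sup>2)
      = qpoch_inf q q * qpoch_inf (- q) q * (qpoch_inf (- q) q * qpoch_inf q (q\<^sup>2))"
    by (simp add: power2_eq_square mult_ac)
  also have "\<dots> = qpoch_inf (q\<^sup>2) (q\<^sup>2)"
    by (simp add: euler_qpoch_inf[OF assms] qpoch_inf_mult_minus[OF assms])
  finally have first: "qpoch_inf (q\<^sup>2) (q\<^sup>2) / qpoch_inf q (q\<^sup>2)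
      = qpoch_inf q q * (qpoch_inf (- q) q)\<^sup>2"
    using nz by (simp add: field_simps)
  show ?thesis
    \<comment> \<open>The divisors \<open>a + 2 * b\<close> are -1, 3, -3 and 1 in this order; the
      negative ones swap the two terms of the difference.\<close>
    using H[of 1 "- 1"] H[of 1 1] H[of "- 1" "- 1"] H[of "- 1" 1]
    unfolding first by (simp add: power3_eq_cube power2_eq_square minus_divide_left mult_ac
        del: minus_divide_left[symmetric])
qed

end
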